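(* Let $\mathcal X=\mathbb R^n$ or let $\mathcal X\subseteq\mathbb R^n$ be closed, bounded and convex, and let $f_1,\dots,f_k:\mathbb R^n\to\mathbb R$ be continuously differentiable on $\mathcal X$. For $x\in\mathcal X$ let $d^*(x)$ be the minimizer of $$\min_{d\in\mathcal X-x}\ \max_{\ell=1,\dots,k}\langle\nabla f_\ell(x),d\rangle\quad\text{s.t. }\|d\|\le1,$$ and let $\omega(x)$ be the negative optimal value, that is, $\omega(x):=-\max_{\ell=1,\dots,k}\langle\nabla f_\ell(x),d^*(x)\rangle$. Then the following statements hold: 1. $\omega(x)\ge0$ for all $x\in\mathcal X$. 2. The function $\omega:\mathcal X\to\mathbb R$ is continuous. 3. The following statements are equivalent: (a) the point $x\in\mathcal X$ is not critical; (b) $\omega(x)>0$; (c) $d^*(x)\ne0$. Consequently, the point $x$ is critical if and only if $\omega(x)=0$.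
   Context: $\|\cdot\|=\|\cdot\|_\infty$ is the maximum norm, $\langle\cdot,\cdot\rangle$ is the standard inner product on $\mathbb R^n$, and $\mathcal X-x=\{y-x:y\in\mathcal X\}$ (equal to $\mathbb R^n$ if $\mathcal X=\mathbb R^n$). $\nabla f_\ell(x)$ denotes the gradient of $f_\ell$ at $x$. A point $x\in\mathcal X$ is called critical for the multiobjective problem $\min_{x\in\mathcal X}(f_1(x),\dots,f_k(x))$ iff there is no $d\in\mathcal X-x$ with $\max_{\ell=1,\dots,k}\langle\nabla f_\ell(x),d\rangle<0$.
   Formalization: The minimizer need not be unique (e.g. constant f_1), and then (c)⇒(b) can fail; d*(x) is taken as any choice of minimizers, and (c)⇒(b) is stated under the condition that d*(x)=0 whenever 0 is a minimizer. All other claims hold for every choice. *)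

theory Defs
  imports "HOL-Analysis.Analysis"
begin

definition grad :: "('a::real_inner \<Rightarrow> real) \<Rightarrow> 'a \<Rightarrow> 'a" where
  "grad f x = (THE D. GDERIV f x :> D)"

(* Differentiability is in the full space, at the points of X; X may have empty interior. *)
definition continuously_differentiable_on ::
    "'a::real_inner set \<Rightarrow> ('a \<Rightarrow> real) \<Rightarrow> bool" where
  "continuously_differentiable_on X f \<longleftrightarrow>
     (\<forall>x\<in>X. f differentiable (at x)) \<and> continuous_on X (grad f)"

(* Only meaningful for k > 0, since Max {} is unspecified. *)
definition max_slope ::
    "nat \<Rightarrow> (nat \<Rightarrow> real^'n \<Rightarrow> real) \<Rightarrow> real^'n \<Rightarrow> real^'n \<Rightarrow> real" where
  "max_slope k f x d = Max ((\<lambda>l. grad (f l) x \<bullet> d) ` {1..k})"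

definition shifted :: "(real^'n) set \<Rightarrow> real^'n \<Rightarrow> (real^'n) set" where
  "shifted X x = (\<lambda>y. y - x) ` X"

definition critical ::
    "(real^'n) set \<Rightarrow> nat \<Rightarrow> (nat \<Rightarrow> real^'n \<Rightarrow> real) \<Rightarrow> real^'n \<Rightarrow> bool" where
  "critical X k f x \<longleftrightarrow> \<not> (\<exists>d \<in> shifted X x. max_slope k f x d < 0)"

(* infnorm is the maximum norm; norm on real^'n would be the Euclidean one. *)
definition is_minimizer ::
    "(real^'n) set \<Rightarrow> nat \<Rightarrow> (nat \<Rightarrow> real^'n \<Rightarrow> real) \<Rightarrow> real^'n \<Rightarrow> real^'n \<Rightarrow> bool" where
  "is_minimizer X k f x =
     is_arg_min (max_slope k f x) (\<lambda>d. d \<in> shifted X x \<and> infnorm d \<le> 1)"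

(* dstar is a choice of minimizers; the value does not depend on the choice. *)
definition omega ::
    "nat \<Rightarrow> (nat \<Rightarrow> real^'n \<Rightarrow> real) \<Rightarrow> (real^'n \<Rightarrow> real^'n) \<Rightarrow> real^'n \<Rightarrow> real" where
  "omega k f dstar x = - max_slope k f x (dstar x)"

end

(* The optimal value at x and the one at y can be compared directly: a direction d feasible at x
   becomes, after adding x - y and shrinking by 1 / (1 + infnorm (x - y)), a direction feasible
   at y whose distance from d is at most a constant times norm (x - y), because X is convex.
   Since the objective is Lipschitz in the direction, the values differ by an amount controlled
   by norm (x - y) and the gradient differences, which gives continuity. The remaining
   assertions compare the optimal value with the value 0 attained at d = 0, and shrink a
   descent direction into the unit ball. *)
theory Submission
  imports Defs
begin

section \<open>Feasible directions and minimizers\<close>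

definition feasible :: "(real^'n) set \<Rightarrow> real^'n \<Rightarrow> (real^'n) set" where
  "feasible X x = {d. d \<in> shifted X x \<and> infnorm d \<le> 1}"

lemma mem_shifted_iff: "d \<in> shifted X x \<longleftrightarrow> x + d \<in> X"
  unfolding shifted_def by (auto simp: image_iff algebra_simps)

lemma feasible_iff: "d \<in> feasible X x \<longleftrightarrow> x + d \<in> X \<and> infnorm d \<le> 1"
  by (simp add: feasible_def mem_shifted_iff)

lemma is_minimizer_iff:
  "is_minimizer X k f x d \<longleftrightarrow>
     d \<in> feasible X x \<and> (\<forall>e\<in>feasible X x. max_slope k f x d \<le> max_slope k f x e)"
  by (auto simp: is_minimizer_def is_arg_min_linorder feasible_def)

lemma zero_feasible: "x \<in> X \<Longrightarrow> 0 \<in> feasible X x"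
  by (simp add: feasible_iff infnorm_0)

text \<open>Directions are constrained in the maximum norm, while the inner product estimates use
  the Euclidean norm; this converts between the two.\<close>

lemma norm_le_sqrt_CARD:
  fixes d :: "real^'n"
  assumes "infnorm d \<le> 1"
  shows "norm d \<le> sqrt CARD('n)"
proof -
  have "norm d \<le> sqrt CARD('n) * infnorm d"
    using norm_le_infnorm[of d] by simp
  also have "\<dots> \<le> sqrt CARD('n)"
    using assms by (intro mult_left_le) auto
  finally show ?thesis .
qed

section \<open>Estimates for the maximal slope\<close>

lemma max_slope_le_iff:
  "k \<ge> 1 \<Longrightarrow> max_slope k f x d \<le> a \<longleftrightarrow> (\<forall>l\<in>{1..k}. grad (f l) x \<bullet> d \<le> a)"
  unfolding max_slope_def by (subst Max_le_iff) auto

lemma max_slope_less_iff: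
  "k \<ge> 1 \<Longrightarrow> max_slope k f x d < a \<longleftrightarrow> (\<forall>l\<in>{1..k}. grad (f l) x \<bullet> d < a)"
  unfolding max_slope_def by (subst Max_less_iff) auto

lemma inner_le_max_slope: "l \<in> {1..k} \<Longrightarrow> grad (f l) x \<bullet> d \<le> max_slope k f x d"
  unfolding max_slope_def by (rule Max_ge) auto

lemma max_slope_zero: "k \<ge> 1 \<Longrightarrow> max_slope k f x 0 = 0"
  by (simp add: max_slope_def image_constant_conv)

text \<open>Each slope splits into the old slope, a change of direction and a change of gradient,
  and Cauchy-Schwarz bounds the two changes. Summing the norms over all indices makes the bounds
  independent of \<open>l\<close>, so they pass to the maximum.\<close>

lemma max_slope_perturb:
  assumes "k \<ge> 1"
  shows "max_slope k f y e \<le> max_slope k f x d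
    + (\<Sum>l=1..k. norm (grad (f l) x)) * norm (e - d)
    + (\<Sum>l=1..k. norm (grad (f l) y - grad (f l) x)) * norm e"
proof -
  have "grad (f l) y \<bullet> e \<le> max_slope k f x d
      + (\<Sum>l=1..k. norm (grad (f l) x)) * norm (e - d)
      + (\<Sum>l=1..k. norm (grad (f l) y - grad (f l) x)) * norm e"
    if l: "l \<in> {1..k}" for l
  proof -
    have "grad (f l) y \<bullet> e = grad (f l) x \<bullet> d + grad (f l) x \<bullet> (e - d)
        + (grad (f l) y - grad (f l) x) \<bullet> e"
      by (simp add: inner_diff_left inner_diff_right)
    moreover have "grad (f l) x \<bullet> d \<le> max_slope k f x d"
      using l by (rule inner_le_max_slope)
    moreover have "grad (f l) x \<bullet> (e - d) \<le> (\<Sum>l=1..k. norm (grad (f l) x)) * norm (e - d)"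
      by (rule order_trans[OF norm_cauchy_schwarz mult_right_mono])
        (use member_le_sum[OF l, of "\<lambda>l. norm (grad (f l) x)"] in auto)
    moreover have "(grad (f l) y - grad (f l) x) \<bullet> e
        \<le> (\<Sum>l=1..k. norm (grad (f l) y - grad (f l) x)) * norm e"
      by (rule order_trans[OF norm_cauchy_schwarz mult_right_mono])
        (use member_le_sum[OF l, of "\<lambda>l. norm (grad (f l) y - grad (f l) x)"] in auto)
    ultimately show ?thesis by linarith
  qed
  then show ?thesis using assms by (simp add: max_slope_le_iff)
qed

lemma continuous_on_max_slope:
  assumes "k \<ge> 1"
  shows "continuous_on S (max_slope k f x)"
proof -
  define C where "C = (\<Sum>l=1..k. norm (grad (f l) x))"
  \<comment> \<open>With the same base point on both sides, the gradient differences vanish and only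
    the change of direction remains.\<close>
  have le: "max_slope k f x e \<le> max_slope k f x d + C * norm (e - d)" for d e
    using max_slope_perturb[OF assms, of f x e x d] by (simp add: C_def)
  have "C-lipschitz_on S (max_slope k f x)"
  proof (rule lipschitz_onI)
    show "0 \<le> C" by (simp add: C_def sum_nonneg)
    show "dist (max_slope k f x d) (max_slope k f x e) \<le> C * dist d e" for d e
      using le[of d e] le[of e d] by (simp add: dist_norm norm_minus_commute abs_le_iff)
  qed
  then show ?thesis by (rule lipschitz_on_continuous_on)
qed

section \<open>Existence of minimizers\<close>

lemma compact_feasible:
  fixes X :: "(real^'n) set"
  assumes "closed X"
  shows "compact (feasible X x)"
proof -
  have "feasible X x = shifted X x \<inter> {d. infnorm d \<le> 1}"
    by (auto simp: feasible_def)
  moreover have "closed (shifted X x)"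
    unfolding shifted_def using closed_translation_subtract[OF assms] by simp
  moreover have "closed {d::real^'n. infnorm d \<le> 1}"
    by (intro closed_Collect_le continuous_intros)
  \<comment> \<open>Boundedness comes from the norm constraint, so the case \<open>X = UNIV\<close>
    is covered.\<close>
  moreover have "bounded {d::real^'n. infnorm d \<le> 1}"
    using norm_le_sqrt_CARD by (auto simp: bounded_iff)
  ultimately show ?thesis
    by (simp add: compact_eq_bounded_closed bounded_Int closed_Int)
qed

lemma minimizer_exists:
  assumes "k \<ge> 1" "closed X" "x \<in> X"
  shows "\<exists>d. is_minimizer X k f x d"
proof -
  have "feasible X x \<noteq> {}" using zero_feasible[OF assms(3)] by blast
  from continuous_attains_inf[OF compact_feasible[OF assms(2)] this
      continuous_on_max_slope[OF assms(1)], of f x]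
  show ?thesis by (auto simp: is_minimizer_iff)
qed

section \<open>Continuity of the optimal value\<close>

lemma feasible_transfer:
  fixes X :: "(real^'n) set"
  assumes "convex X" "y \<in> X" "d \<in> feasible X x"
  obtains e where "e \<in> feasible X y"
    and "norm (e - d) \<le> (1 + sqrt CARD('n)) * norm (x - y)"
proof -
  define \<delta> where "\<delta> = infnorm (x - y)"
  define s where "s = 1 / (1 + \<delta>)"
  \<comment> \<open>The point \<open>y + e\<close> lies on the segment from \<open>y\<close> to
    \<open>x + d\<close>. Since \<open>x + d - y\<close> has maximum norm at most
    \<open>1 + \<delta>\<close>, the factor \<open>s\<close> brings it back into the unit
    ball.\<close>
  define e where "e = s *\<^sub>R (x + d - y)"
  have \<delta>: "0 \<le> \<delta>" "\<delta> \<le> norm (x - y)"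
    by (simp_all add: \<delta>_def infnorm_pos_le infnorm_le_norm)
  then have s: "0 \<le> s" "s \<le> 1" "1 - s \<le> \<delta>" "s * (1 + \<delta>) = 1"
    by (simp_all add: s_def field_simps)
  have d: "x + d \<in> X" "infnorm d \<le> 1"
    using assms(3) by (simp_all add: feasible_iff)
  have "y + e = (1 - s) *\<^sub>R y + s *\<^sub>R (x + d)"
    by (simp add: e_def algebra_simps)
  then have "y + e \<in> X"
    using convexD_alt[OF assms(1,2) d(1)] s by simp
  moreover have "infnorm e \<le> 1"
  proof -
    have "infnorm (x + d - y) \<le> \<delta> + 1"
      using infnorm_triangle[of "x - y" d] d(2) by (simp add: \<delta>_def algebra_simps)
    then have "s * infnorm (x + d - y) \<le> s * (1 + \<delta>)"
      using s(1) by (intro mult_left_mono) auto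
    then show ?thesis using s by (simp add: e_def infnorm_mul)
  qed
  moreover have "norm (e - d) \<le> (1 + sqrt CARD('n)) * norm (x - y)"
  proof -
    \<comment> \<open>The shift by \<open>x - y\<close> accounts for the \<open>1\<close> in the
      constant, the shrinking of \<open>d\<close> for \<open>sqrt CARD('n)\<close>, because
      \<open>1 - s \<le> \<delta>\<close>.\<close>
    have "e - d = s *\<^sub>R (x - y) - (1 - s) *\<^sub>R d"
      by (simp add: e_def algebra_simps)
    then have "norm (e - d) \<le> s * norm (x - y) + (1 - s) * norm d"
      using norm_triangle_ineq4[of "s *\<^sub>R (x - y)" "(1 - s) *\<^sub>R d"] s by simp
    moreover have "s * norm (x - y) \<le> norm (x - y)"
      using s by (simp add: mult_left_le_one_le)
    moreover have "(1 - s) * norm d \<le> norm (x - y) * sqrt CARD('n)"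
      using s \<delta> norm_le_sqrt_CARD[OF d(2)] by (intro mult_mono) auto
    ultimately show ?thesis by (simp add: algebra_simps)
  qed
  ultimately show thesis using that by (simp add: feasible_iff)
qed

text \<open>The minimizer at \<open>y\<close> does at least as well as the direction transferred
  from \<open>x\<close>. The bound is one-sided; exchanging the points gives the other side.\<close>

lemma minimal_max_slope_le:
  fixes X :: "(real^'n) set"
  assumes "k \<ge> 1" "convex X" "y \<in> X"
    and "is_minimizer X k f x d" "is_minimizer X k f y e"
  shows "max_slope k f y e \<le> max_slope k f x d
    + (\<Sum>l=1..k. norm (grad (f l) x)) * ((1 + sqrt CARD('n)) * norm (x - y))
    + (\<Sum>l=1..k. norm (grad (f l) y - grad (f l) x)) * sqrt CARD('n)"
proof -
  have "d \<in> feasible X x" using assms(4) by (simp add: is_minimizer_iff)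
  from feasible_transfer[OF assms(2,3) this]
  obtain e' where e': "e' \<in> feasible X y"
    "norm (e' - d) \<le> (1 + sqrt CARD('n)) * norm (x - y)" by blast
  have "max_slope k f y e \<le> max_slope k f y e'"
    using assms(5) e'(1) by (simp add: is_minimizer_iff)
  also have "\<dots> \<le> max_slope k f x d
    + (\<Sum>l=1..k. norm (grad (f l) x)) * norm (e' - d)
    + (\<Sum>l=1..k. norm (grad (f l) y - grad (f l) x)) * norm e'"
    by (rule max_slope_perturb[OF assms(1)])
  also have "\<dots> \<le> max_slope k f x d
    + (\<Sum>l=1..k. norm (grad (f l) x)) * ((1 + sqrt CARD('n)) * norm (x - y))
    + (\<Sum>l=1..k. norm (grad (f l) y - grad (f l) x)) * sqrt CARD('n)"
    using e' by (intro add_mono mult_left_mono order_refl norm_le_sqrt_CARD)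
      (auto simp: feasible_iff intro: sum_nonneg)
  finally show ?thesis .
qed

lemma continuous_on_omega:
  fixes X :: "(real^'n) set"
  assumes k: "k \<ge> 1" and X: "convex X"
    and grad: "\<And>l. l \<in> {1..k} \<Longrightarrow> continuous_on X (grad (f l))"
    and min: "\<And>x. x \<in> X \<Longrightarrow> is_minimizer X k f x (dstar x)"
  shows "continuous_on X (omega k f dstar)"
  unfolding continuous_on_def
proof
  fix x assume x: "x \<in> X"
  define c where "c = sqrt CARD('n)"
  \<comment> \<open>The two one-sided estimates carry the gradient norms at \<open>x\<close> and at
    \<open>y\<close> respectively; their sum dominates both.\<close>
  define B where "B y =
      ((\<Sum>l=1..k. norm (grad (f l) x)) + (\<Sum>l=1..k. norm (grad (f l) y))) * ((1 + c) * norm (x - y))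
      + (\<Sum>l=1..k. norm (grad (f l) y - grad (f l) x)) * c" for y
  have "((\<lambda>y. grad (f l) y) \<longlongrightarrow> grad (f l) x) (at x within X)" if "l \<in> {1..k}" for l
    using grad[OF that] x by (simp add: continuous_on_def)
  then have "(B \<longlongrightarrow> ((\<Sum>l=1..k. norm (grad (f l) x)) + (\<Sum>l=1..k. norm (grad (f l) x)))
        * ((1 + c) * norm (x - x)) + (\<Sum>l=1..k. norm (grad (f l) x - grad (f l) x)) * c)
      (at x within X)"
    unfolding B_def by (intro tendsto_intros)
  then have B: "(B \<longlongrightarrow> 0) (at x within X)" by simp
  have "norm (omega k f dstar y - omega k f dstar x) \<le> B y" if y: "y \<in> X" for y
  proof -
    note le1 = minimal_max_slope_le[OF k X y min[OF x] min[OF y], folded c_def]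
    note le2 = minimal_max_slope_le[OF k X x min[OF y] min[OF x], folded c_def]
    have "0 \<le> (\<Sum>l=1..k. norm (grad (f l) z)) * ((1 + c) * norm (x - y))" for z
      by (simp add: c_def sum_nonneg)
    from this[of x] this[of y] le1 le2 show ?thesis
      by (simp add: omega_def B_def norm_minus_commute distrib_right abs_le_iff)
  qed
  then have "\<forall>\<^sub>F y in at x within X. norm (omega k f dstar y - omega k f dstar x) \<le> B y"
    by (auto simp: eventually_at_filter)
  from Lim_null_comparison[OF this B]
  show "(omega k f dstar \<longlongrightarrow> omega k f dstar x) (at x within X)"
    by (rule LIM_zero_cancel)
qed

section \<open>Criticality and the sign of the optimal value\<close>

lemma not_critical_iff:
  assumes k: "k \<ge> 1" and X: "convex X" and x: "x \<in> X"
    and min: "is_minimizer X k f x d"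
  shows "\<not> critical X k f x \<longleftrightarrow> max_slope k f x d < 0"
proof
  assume "\<not> critical X k f x"
  then obtain e where e: "x + e \<in> X" "max_slope k f x e < 0"
    by (auto simp: critical_def mem_shifted_iff)
  \<comment> \<open>This factor lies in \<open>(0, 1]\<close>, so convexity keeps
    \<open>x + s *\<^sub>R e\<close> in \<open>X\<close>; it puts the direction into the unit ball,
    and every slope stays negative because \<open>s\<close> is positive.\<close>
  define s where "s = 1 / (1 + infnorm e)"
  have s: "0 < s" "s \<le> 1" "s * infnorm e \<le> 1"
    using infnorm_pos_le[of e] by (simp_all add: s_def field_simps)
  have "(1 - s) *\<^sub>R x + s *\<^sub>R (x + e) \<in> X"
    using convexD_alt[OF X x e(1)] s by simp
  moreover have "(1 - s) *\<^sub>R x + s *\<^sub>R (x + e) = x + s *\<^sub>R e"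
    by (simp add: algebra_simps)
  ultimately have "s *\<^sub>R e \<in> feasible X x"
    using s by (simp add: feasible_iff infnorm_mul)
  then have "max_slope k f x d \<le> max_slope k f x (s *\<^sub>R e)"
    using min by (simp add: is_minimizer_iff)
  also have "\<dots> < 0"
    using e(2) s k by (simp add: max_slope_less_iff mult_pos_neg)
  finally show "max_slope k f x d < 0" .
next
  assume "max_slope k f x d < 0"
  then show "\<not> critical X k f x"
    using min by (auto simp: critical_def is_minimizer_iff feasible_def)
qed

(* Minimizers need not be unique: at a critical point 0 is a minimizer, but there may be
   nonzero ones as well (all feasible d, if the gradients vanish). The comparison with
   dstar x \<noteq> 0 therefore assumes that dstar x is 0 whenever 0 is a minimizer; this holds in
   particular whenever the minimizer at x is unique. *)
theorem theorem1:
  fixes X :: "(real^'n) set"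
    and f :: "nat \<Rightarrow> real^'n \<Rightarrow> real"
    and k :: nat
  assumes "X = UNIV \<or> (closed X \<and> bounded X \<and> convex X)"
    and "k \<ge> 1"
    and "\<And>l. l \<in> {1..k} \<Longrightarrow> continuously_differentiable_on X (f l)"
  shows "(\<forall>x\<in>X. \<exists>d. is_minimizer X k f x d) \<and>
    (\<forall>dstar. (\<forall>x\<in>X. is_minimizer X k f x (dstar x)) \<longrightarrow>
       (\<forall>x\<in>X. omega k f dstar x \<ge> 0) \<and>
       continuous_on X (omega k f dstar) \<and>
       (\<forall>x\<in>X.
          (\<not> critical X k f x \<longleftrightarrow> omega k f dstar x > 0) \<and>
          (omega k f dstar x > 0 \<longrightarrow> dstar x \<noteq> 0) \<and>
          ((is_minimizer X k f x 0 \<longrightarrow> dstar x = 0) \<longrightarrow>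
             (dstar x \<noteq> 0 \<longrightarrow> omega k f dstar x > 0))) \<and>
       (\<forall>x\<in>X. critical X k f x \<longleftrightarrow> omega k f dstar x = 0))"
proof -
  have X: "closed X" "convex X" using assms(1) by auto
  have grad: "continuous_on X (grad (f l))" if "l \<in> {1..k}" for l
    using assms(3)[OF that] by (simp add: continuously_differentiable_on_def)
  have main: "omega k f dstar x \<ge> 0 \<and>
      (\<not> critical X k f x \<longleftrightarrow> omega k f dstar x > 0) \<and>
      (omega k f dstar x > 0 \<longrightarrow> dstar x \<noteq> 0) \<and>
      ((is_minimizer X k f x 0 \<longrightarrow> dstar x = 0) \<longrightarrow>
         (dstar x \<noteq> 0 \<longrightarrow> omega k f dstar x > 0)) \<and>
      (critical X k f x \<longleftrightarrow> omega k f dstar x = 0)"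
    if x: "x \<in> X" and min: "is_minimizer X k f x (dstar x)" for x dstar
  proof -
    note zero = zero_feasible[OF x] and slope0 = max_slope_zero[OF assms(2), of f x]
    have nonneg: "omega k f dstar x \<ge> 0"
      using min zero slope0 by (force simp: omega_def is_minimizer_iff)
    have crit: "\<not> critical X k f x \<longleftrightarrow> omega k f dstar x > 0"
      using not_critical_iff[OF assms(2) X(2) x min] by (simp add: omega_def)
    \<comment> \<open>Some feasible direction then beats the value 0 attained at the zero direction.
      Under the convention on \<open>dstar\<close>, \<open>dstar x \<noteq> 0\<close> implies the
      assumption made here.\<close>
    have "omega k f dstar x > 0" if not_min: "\<not> is_minimizer X k f x 0"
    proof -
      obtain e where "e \<in> feasible X x" "max_slope k f x e < 0"
        using not_min zero slope0 by (auto simp: is_minimizer_iff not_le)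
      then show ?thesis using min by (force simp: omega_def is_minimizer_iff)
    qed
    moreover have "dstar x \<noteq> 0" if "omega k f dstar x > 0"
      using that slope0 by (auto simp: omega_def)
    ultimately show ?thesis using nonneg crit by auto
  qed
  have cont: "continuous_on X (omega k f dstar)"
    if min: "\<forall>x\<in>X. is_minimizer X k f x (dstar x)" for dstar
    using assms(2) X(2)
  proof (rule continuous_on_omega)
    show "continuous_on X (grad (f l))" if "l \<in> {1..k}" for l using that by (rule grad)
    show "is_minimizer X k f x (dstar x)" if "x \<in> X" for x using min that by (rule bspec)
  qed
  show ?thesis
  proof (intro conjI allI impI)
    show "\<forall>x\<in>X. \<exists>d. is_minimizer X k f x d"
      using minimizer_exists[OF assms(2) X(1)] by blast
  next
    fix dstar assume min: "\<forall>x\<in>X. is_minimizer X k f x (dstar x)"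
    note main' = main[where dstar = dstar, OF _ bspec[OF min]]
    show "\<forall>x\<in>X. omega k f dstar x \<ge> 0" using main' by blast
    show "continuous_on X (omega k f dstar)" using min by (rule cont)
    show "\<forall>x\<in>X.
          (\<not> critical X k f x \<longleftrightarrow> omega k f dstar x > 0) \<and>
          (omega k f dstar x > 0 \<longrightarrow> dstar x \<noteq> 0) \<and>
          ((is_minimizer X k f x 0 \<longrightarrow> dstar x = 0) \<longrightarrow>
             (dstar x \<noteq> 0 \<longrightarrow> omega k f dstar x > 0))"
      using main' by blast
    show "\<forall>x\<in>X. critical X k f x \<longleftrightarrow> omega k f dstar x = 0" using main' by blast
  qed
qed

end
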